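(* Suppose that $A$ and $B$ are paramonotone, let $\rho>0$, and let $x\in X$. Then the following hold: (i) If $k_0\in K$, then $J_{\rho A}P_{Z-\rho\overline{L^*K}}(x)=P_Z(x+\rho L^*k_0)$. (ii) If $z_0\in Z$ and $(Z-z_0)\perp\rho L^*K$, then $J_{\rho A}P_{Z-\rho\overline{L^*K}}(x)=P_Z(x)$. (iii) If $K\cap\ker L^*\neq\varnothing$, then $J_{\rho A}P_{Z-\rho\overline{L^*K}}(x)=P_Z(x)$.
   Context: $X$ and $Y$ are real Hilbert spaces, $L\colon X\to Y$ is continuous and linear with adjoint $L^*$, and $A\colon X\rightrightarrows X$ and $B\colon Y\rightrightarrows Y$ are maximally monotone set-valued operators. Inverses are in the sense of set-valued operators. Set $$Z:=\{x\in X: 0\in Ax+L^*BLx\},\qquad K:=\{y\in Y: 0\in B^{-1}y-LA^{-1}(-L^*y)\}.$$ A monotone operator $A$ is paramonotone if $(x_0,u_0),(x_1,u_1)\in\operatorname{gra}A$ and $\langle x_0-x_1,u_0-u_1\rangle=0$ imply $(x_0,u_1)\in\operatorname{gra}A$ and $(x_1,u_0)\in\operatorname{gra}A$. $J_{\rho A}:=(\operatorname{Id}+\rho A)^{-1}$ is the resolvent. $P_C$ is the projection onto a nonempty closed convex set $C$; $\overline{D}$ is the (norm) closure of $D$; sums, differences and scalar multiples of sets are in the Minkowski sense; $C\perp D$ means $\langle c,d\rangle=0$ for all $c\in C$, $d\in D$. Under paramonotonicity of $A$ and $B$, whenever $Z$ and $K$ are nonempty (and $Z\ne\varnothing$ iff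 $K\neq\varnothing$), the sets $Z$ and $Z-\rho\overline{L^*K}$ are nonempty, closed and convex, so the projections are well defined. *)

theory Defs
  imports "HOL-Analysis.Analysis"
begin

(* A set-valued operator is identified with its graph, so that "A `` {x}" is the value A x,
   "A\<inverse>" is the set-valued inverse and "Id" is the identity operator. *)

definition monotone_operator :: "('a::real_inner) rel \<Rightarrow> bool" where
  "monotone_operator A \<longleftrightarrow>
    (\<forall>(x, u) \<in> A. \<forall>(y, v) \<in> A. (x - y) \<bullet> (u - v) \<ge> 0)"

definition maximally_monotone :: "('a::real_inner) rel \<Rightarrow> bool" where
  "maximally_monotone A \<longleftrightarrow>
    monotone_operator A \<and> (\<forall>A'. monotone_operator A' \<and> A \<subseteq> A' \<longrightarrow> A' = A)"

definition paramonotone :: "('a::real_inner) rel \<Rightarrow> bool" where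
  "paramonotone A \<longleftrightarrow> monotone_operator A \<and>
    (\<forall>x\<^sub>0 u\<^sub>0 x\<^sub>1 u\<^sub>1. (x\<^sub>0, u\<^sub>0) \<in> A \<and> (x\<^sub>1, u\<^sub>1) \<in> A \<and> (x\<^sub>0 - x\<^sub>1) \<bullet> (u\<^sub>0 - u\<^sub>1) = 0
       \<longrightarrow> (x\<^sub>0, u\<^sub>1) \<in> A \<and> (x\<^sub>1, u\<^sub>0) \<in> A)"

definition op_plus :: "('a::real_vector) rel \<Rightarrow> 'a rel \<Rightarrow> 'a rel" where
  "op_plus A B = {(x, u + v) | x u v. (x, u) \<in> A \<and> (x, v) \<in> B}"

definition op_scale :: "real \<Rightarrow> ('a::real_vector) rel \<Rightarrow> 'a rel" where
  "op_scale \<rho> A = {(x, \<rho> *\<^sub>R u) | x u. (x, u) \<in> A}"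

(* Set-valued: for maximally monotone A, single-valuedness and full domain of the resolvent
   are theorems. "resolvent A `` {x} = {y}" states that it is single-valued at x with value y. *)
definition resolvent :: "('a::real_vector) rel \<Rightarrow> 'a rel" where
  "resolvent A = (op_plus Id A)\<inverse>"

(* The Minkowski difference; binary "-" on sets is the set-theoretic difference.
   The Minkowski sum "+" is the one of HOL-Library.Set_Algebras. *)
definition minkowski_diff :: "('a::ab_group_add) set \<Rightarrow> 'a set \<Rightarrow> 'a set"  (infixl \<open>\<ominus>\<^sub>M\<close> 65) where
  "C \<ominus>\<^sub>M D = {c - d | c d. c \<in> C \<and> d \<in> D}"

definition minkowski_scale :: "real \<Rightarrow> ('a::real_vector) set \<Rightarrow> 'a set"  (infixr \<open>\<cdot>\<^sub>M\<close> 75) where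
  "\<rho> \<cdot>\<^sub>M C = (\<lambda>c. \<rho> *\<^sub>R c) ` C"

definition orthogonal_sets :: "('a::real_inner) set \<Rightarrow> 'a set \<Rightarrow> bool" where
  "orthogonal_sets C D \<longleftrightarrow> (\<forall>c \<in> C. \<forall>d \<in> D. orthogonal c d)"

(* The library's closest_point is restricted to heine_borel, that is, to finite dimension. *)
definition projection :: "('a::real_inner) set \<Rightarrow> 'a \<Rightarrow> 'a" where
  "projection C x = (THE p. p \<in> C \<and> (\<forall>c \<in> C. dist x p \<le> dist x c))"

definition primal_solutions ::
  "('a::real_inner \<Rightarrow> 'b::real_inner) \<Rightarrow> 'a rel \<Rightarrow> 'b rel \<Rightarrow> 'a set" where
  "primal_solutions L A B = {x. 0 \<in> A `` {x} + adjoint L ` (B `` {L x})}"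

definition dual_solutions ::
  "('a::real_inner \<Rightarrow> 'b::real_inner) \<Rightarrow> 'a rel \<Rightarrow> 'b rel \<Rightarrow> 'b set" where
  "dual_solutions L A B = {y. 0 \<in> B\<inverse> `` {y} \<ominus>\<^sub>M L ` (A\<inverse> `` {- adjoint L y})}"

end

theory Submission
  imports Defs
begin

text \<open>Paramonotonicity makes every primal solution \<open>z\<close> pair with every dual solution \<open>k\<close>:
  \<open>- L\<^sup>* k \<in> A z\<close> and \<open>k \<in> B (L z)\<close>. Indeed a solution of either problem comes with some partner in
  the other, and for two such pairs the monotonicity inequalities of \<open>A\<close> and \<open>B\<close> are
  negatives of each other, hence equalities (\<open>primal_dual_pairing\<close>). Write \<open>D\<close> for the closure of
  \<open>L\<^sup>* K\<close>. Three consequences carry the theorem.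

  First, fixing any \<open>k\<close>, the set \<open>Z\<close> is cut out by \<open>- L\<^sup>* k \<in> A z\<close> and \<open>k \<in> B (L z)\<close>, so it is closed and
  convex because fibres of maximally monotone operators are; likewise \<open>K\<close> is convex. Second,
  \<open>- d \<in> A z\<close> for all \<open>z \<in> Z\<close> and \<open>d \<in> D\<close>, which says that the resolvent of \<open>\<rho> A\<close> maps \<open>z - \<rho> d\<close> to
  \<open>z\<close>. Third, monotonicity applied to \<open>(z, - d)\<close>, \<open>(w, - e)\<close> and to \<open>(z, - e)\<close>, \<open>(w, - d)\<close> gives
  \<open>\<langle>z - w, d - e\<rangle> = 0\<close>, so \<open>Z\<close> and \<open>D\<close> lie in orthogonal directions.

  By this orthogonality, minimising over \<open>Z - \<rho> D\<close> splits into a problem in \<open>z\<close> and one in \<open>d\<close>.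
  With \<open>d\<^sub>0 \<in> D\<close> fixed, the linear term \<open>\<rho> d\<close> can be replaced by \<open>\<rho> d\<^sub>0\<close> when \<open>z\<close> varies, so the
  \<open>z\<close>-component of the projection of \<open>x\<close> is the projection of \<open>x + \<rho> d\<^sub>0\<close> onto \<open>Z\<close>
  (\<open>projection_orthogonal_difference\<close>). The resolvent returns this component: this is the first
  claim. In the other two claims the shift \<open>\<rho> d\<^sub>0\<close> is orthogonal to \<open>Z - z\<^sub>0\<close>, or zero, and does not
  affect the projection onto \<open>Z\<close>.

  The projection theorem and the adjoint are developed for complete inner product spaces, since
  the spaces may be infinite-dimensional.\<close>

section \<open>Projections in Hilbert spaces\<close>

text \<open>The variational inequality forces \<open>\<parallel>x - c\<parallel>\<^sup>2 \<ge> \<parallel>x - p\<parallel>\<^sup>2 + \<parallel>p - c\<parallel>\<^sup>2\<close> for all \<open>c \<in> C\<close>, which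
  makes \<open>p\<close> the unique nearest point. For a difference set \<open>Z - \<rho> D\<close> this identifies the
  projection by exhibiting it, without a separate existence argument.\<close>

lemma projection_eqI:
  fixes C :: "'a::real_inner set"
  assumes p: "p \<in> C" and var: "\<And>c. c \<in> C \<Longrightarrow> (x - p) \<bullet> (c - p) \<le> 0"
  shows "projection C x = p"
proof -
  have pyth: "(dist x p)\<^sup>2 + (dist p c)\<^sup>2 \<le> (dist x c)\<^sup>2" if "c \<in> C" for c
    using var[OF that]
    by (simp add: dist_norm power2_norm_eq_inner inner_diff_left inner_diff_right inner_commute)
  show ?thesis
    unfolding projection_def
  proof (rule the_equality)
    have "dist x p \<le> dist x c" if "c \<in> C" for c
      by (rule power2_le_imp_le) (use pyth[OF that] zero_le_power2[of "dist p c"] in linarith, simp)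
    then show "p \<in> C \<and> (\<forall>c\<in>C. dist x p \<le> dist x c)"
      using p by blast
  next
    fix q assume q: "q \<in> C \<and> (\<forall>c\<in>C. dist x q \<le> dist x c)"
    then have "(dist x q)\<^sup>2 \<le> (dist x p)\<^sup>2"
      using p by (intro power_mono) auto
    with pyth[of q] q have "(dist p q)\<^sup>2 \<le> 0"
      by linarith
    then show "q = p"
      by simp
  qed
qed

text \<open>Completeness replaces compactness here: by the parallelogram identity, minimising sequences
  are Cauchy, because the midpoint of two almost nearest points of \<open>C\<close> is again in \<open>C\<close>.\<close>

lemma nearest_point_exists:
  fixes C :: "'a::{real_inner, complete_space} set"
  assumes "closed C" "convex C" "C \<noteq> {}"
  obtains p where "p \<in> C" "\<And>c. c \<in> C \<Longrightarrow> dist x p \<le> dist x c"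
proof -
  define m where "m = (INF c\<in>C. (dist x c)\<^sup>2)"
  have bdd: "bdd_below ((\<lambda>c. (dist x c)\<^sup>2) ` C)"
    by (rule bdd_belowI[of _ 0]) auto
  have m_le: "m \<le> (dist x c)\<^sup>2" if "c \<in> C" for c
    unfolding m_def by (rule cINF_lower[OF bdd that])
  have "\<exists>c\<in>C. (dist x c)\<^sup>2 < m + inverse (real (Suc n))" for n
  proof -
    have "m < m + inverse (real (Suc n))" by simp
    then show ?thesis
      unfolding m_def using cINF_less_iff[OF \<open>C \<noteq> {}\<close> bdd] by blast
  qed
  then obtain y where yC: "\<And>n. y n \<in> C"
    and y: "\<And>n. (dist x (y n))\<^sup>2 < m + inverse (real (Suc n))"
    by metis
  have near: "(dist (y i) (y j))\<^sup>2 < 2 * inverse (real (Suc i)) + 2 * inverse (real (Suc j))" for i j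
  proof -
    let ?c = "(1/2) *\<^sub>R y i + (1/2) *\<^sub>R y j"
    have "?c \<in> C"
      using convexD[OF \<open>convex C\<close> yC yC, of "1/2" "1/2"] by simp
    then have "m \<le> (dist x ?c)\<^sup>2"
      by (rule m_le)
    moreover have "(dist (y i) (y j))\<^sup>2
        = 2 * (dist x (y i))\<^sup>2 + 2 * (dist x (y j))\<^sup>2 - 4 * (dist x ?c)\<^sup>2"
      unfolding dist_norm power2_norm_eq_inner
      by (simp add: inner_diff_left inner_diff_right inner_add_left inner_add_right
          inner_commute field_simps)
    ultimately show ?thesis
      using y[of i] y[of j] by linarith
  qed
  have "Cauchy y"
  proof (rule metric_CauchyI)
    fix e :: real assume "e > 0"
    then obtain N where N: "inverse (real (Suc N)) < e\<^sup>2 / 4"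
      using reals_Archimedean[of "e\<^sup>2 / 4"] by auto
    have "dist (y i) (y j) < e" if "i \<ge> N" "j \<ge> N" for i j
    proof (rule power2_less_imp_less)
      have "inverse (real (Suc k)) \<le> inverse (real (Suc N))" if "k \<ge> N" for k
        using that by (intro le_imp_inverse_le) auto
      from this[of i] this[of j] that N near[of i j]
      show "(dist (y i) (y j))\<^sup>2 < e\<^sup>2" by linarith
    qed (use \<open>e > 0\<close> in simp)
    then show "\<exists>M. \<forall>i\<ge>M. \<forall>j\<ge>M. dist (y i) (y j) < e" by blast
  qed
  then obtain p where lim: "y \<longlonglongrightarrow> p"
    using Cauchy_convergent convergent_def by blast
  have pC: "p \<in> C"
    using closed_sequentially[OF \<open>closed C\<close>] yC lim by blast
  have "(\<lambda>n. (dist x (y n))\<^sup>2) \<longlonglongrightarrow> (dist x p)\<^sup>2"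
    by (intro tendsto_intros lim)
  moreover have "(\<lambda>n. m + inverse (real (Suc n))) \<longlonglongrightarrow> m + 0"
    by (intro tendsto_intros LIMSEQ_inverse_real_of_nat)
  ultimately have "(dist x p)\<^sup>2 \<le> m + 0"
    by (rule LIMSEQ_le) (use y less_imp_le in blast)
  then have "(dist x p)\<^sup>2 \<le> (dist x c)\<^sup>2" if "c \<in> C" for c
    using m_le[OF that] by linarith
  then have "dist x p \<le> dist x c" if "c \<in> C" for c
    using that power2_le_imp_le[OF _ zero_le_dist] by blast
  with pC show thesis using that by blast
qed

lemma projection_variational:
  fixes C :: "'a::{real_inner, complete_space} set"
  assumes C: "closed C" "convex C" "C \<noteq> {}"
  shows "projection C x \<in> C"
    and "c \<in> C \<Longrightarrow> (x - projection C x) \<bullet> (c - projection C x) \<le> 0"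
proof -
  obtain p where p: "p \<in> C" "\<And>c. c \<in> C \<Longrightarrow> dist x p \<le> dist x c"
    using nearest_point_exists[OF C] by blast
  have var: "(x - p) \<bullet> (c - p) \<le> 0" if "c \<in> C" for c
    using any_closest_point_dot[of C p c x] C p that by blast
  have "projection C x = p"
    using p(1) var by (rule projection_eqI)
  with p(1) var show "projection C x \<in> C"
    and "c \<in> C \<Longrightarrow> (x - projection C x) \<bullet> (c - projection C x) \<le> 0"
    by auto
qed

lemma projection_shift_orthogonal:
  fixes C :: "'a::{real_inner, complete_space} set"
  assumes C: "closed C" "convex C" "C \<noteq> {}"
    and orth: "\<And>c. c \<in> C \<Longrightarrow> (c - c\<^sub>0) \<bullet> v = 0"
  shows "projection C (x + v) = projection C x"
proof (rule projection_eqI)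
  let ?p = "projection C x"
  show p: "?p \<in> C" by (rule projection_variational(1)[OF C])
  fix c assume c: "c \<in> C"
  have "v \<bullet> (c - ?p) = 0"
    using orth[OF c] orth[OF p] by (simp add: inner_diff_left inner_diff_right inner_commute)
  then show "(x + v - ?p) \<bullet> (c - ?p) \<le> 0"
    using projection_variational(2)[OF C c, of x]
    by (simp add: inner_diff_left inner_add_left)
qed

text \<open>The test vector \<open>z - \<rho> d - (p - \<rho> e)\<close> splits into \<open>z - p\<close> and \<open>- \<rho> (d - e)\<close>. In the pairing
  of \<open>x - (p - \<rho> e)\<close> with \<open>z - p\<close> orthogonality turns \<open>\<rho> e\<close> into \<open>\<rho> d\<^sub>0\<close>, which leaves the variational
  inequality for \<open>p\<close>; the second part is the one for \<open>e\<close>, the nearest point of \<open>D\<close> to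
  \<open>(p - x) / \<rho>\<close>.\<close>

lemma projection_orthogonal_difference:
  fixes Z D :: "'a::{real_inner, complete_space} set"
  assumes Z: "closed Z" "convex Z" "Z \<noteq> {}" and D: "closed D" "convex D"
    and orth: "\<And>z w d e. \<lbrakk>z \<in> Z; w \<in> Z; d \<in> D; e \<in> D\<rbrakk> \<Longrightarrow> (z - w) \<bullet> (d - e) = 0"
    and "\<rho> > 0" and d\<^sub>0: "d\<^sub>0 \<in> D"
  obtains e where "e \<in> D"
    "projection (Z \<ominus>\<^sub>M \<rho> \<cdot>\<^sub>M D) x = projection Z (x + \<rho> *\<^sub>R d\<^sub>0) - \<rho> *\<^sub>R e"
proof -
  define p where "p = projection Z (x + \<rho> *\<^sub>R d\<^sub>0)"
  define e where "e = projection D ((1 / \<rho>) *\<^sub>R (p - x))"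
  have "D \<noteq> {}" using d\<^sub>0 by blast
  have p: "p \<in> Z"
    unfolding p_def by (rule projection_variational(1)[OF Z])
  have e: "e \<in> D"
    unfolding e_def by (rule projection_variational(1)[OF D \<open>D \<noteq> {}\<close>])
  have "projection (Z \<ominus>\<^sub>M \<rho> \<cdot>\<^sub>M D) x = p - \<rho> *\<^sub>R e"
  proof (rule projection_eqI)
    show "p - \<rho> *\<^sub>R e \<in> Z \<ominus>\<^sub>M \<rho> \<cdot>\<^sub>M D"
      unfolding minkowski_diff_def minkowski_scale_def using p e by blast
    fix c assume "c \<in> Z \<ominus>\<^sub>M \<rho> \<cdot>\<^sub>M D"
    then obtain z d where c: "c = z - \<rho> *\<^sub>R d" and z: "z \<in> Z" and d: "d \<in> D"
      unfolding minkowski_diff_def minkowski_scale_def by blast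
    define r where "r = x - (p - \<rho> *\<^sub>R e)"
    have "r \<bullet> (z - p) = (x + \<rho> *\<^sub>R d\<^sub>0 - p) \<bullet> (z - p) + \<rho> * ((z - p) \<bullet> (e - d\<^sub>0))"
      by (simp add: r_def algebra_simps inner_commute)
    also have "\<dots> \<le> 0"
      using projection_variational(2)[OF Z z, of "x + \<rho> *\<^sub>R d\<^sub>0"] orth[OF z p e d\<^sub>0]
      by (simp add: p_def)
    finally have 1: "r \<bullet> (z - p) \<le> 0" .
    have "(1 / \<rho>) *\<^sub>R (p - x) - e = - (1 / \<rho>) *\<^sub>R r"
      using \<open>\<rho> > 0\<close> by (simp add: r_def algebra_simps)
    with projection_variational(2)[OF D \<open>D \<noteq> {}\<close> d, of "(1 / \<rho>) *\<^sub>R (p - x)"]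
    have "0 \<le> r \<bullet> (d - e) / \<rho>"
      by (simp add: e_def[symmetric])
    then have 2: "0 \<le> \<rho> * (r \<bullet> (d - e))"
      using \<open>\<rho> > 0\<close> by (simp add: zero_le_divide_iff)
    have "r \<bullet> (c - (p - \<rho> *\<^sub>R e)) = r \<bullet> (z - p) - \<rho> * (r \<bullet> (d - e))"
      by (simp add: c inner_diff_right algebra_simps)
    with 1 2 show "(x - (p - \<rho> *\<^sub>R e)) \<bullet> (c - (p - \<rho> *\<^sub>R e)) \<le> 0"
      unfolding r_def by linarith
  qed
  with e show thesis using that unfolding p_def by blast
qed

section \<open>The adjoint of a bounded operator\<close>

text \<open>A nonzero functional attains the value 1 on a closed hyperplane; the point \<open>p\<close> of that
  hyperplane nearest to 0 is normal to the kernel, so it represents the functional up to scaling.\<close>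

lemma riesz_representation:
  fixes f :: "'a::{real_inner, complete_space} \<Rightarrow> real"
  assumes "bounded_linear f"
  obtains r where "\<And>x. f x = x \<bullet> r"
proof (cases "\<forall>x. f x = 0")
  case True
  then show thesis using that[of 0] by simp
next
  case False
  interpret f: bounded_linear f by fact
  obtain a where a: "f a \<noteq> 0" using False by blast
  define C where "C = {x. f x = 1}"
  have "closed C"
    unfolding C_def by (intro closed_Collect_eq continuous_intros f.continuous_on)
  moreover have "convex C"
    by (auto simp: C_def convex_def f.add f.scaleR)
  moreover have "(1 / f a) *\<^sub>R a \<in> C"
    using a by (simp add: C_def f.scaleR)
  then have "C \<noteq> {}" by blast
  ultimately have C: "closed C" "convex C" "C \<noteq> {}" .
  define p where "p = projection C 0"
  have fp: "f p = 1"
    using projection_variational(1)[OF C, of 0] by (simp add: p_def C_def)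
  have normal: "p \<bullet> n = 0" if "f n = 0" for n
  proof -
    have "p + n \<in> C" "p - n \<in> C"
      using that fp by (auto simp: C_def f.add f.diff)
    from this[THEN projection_variational(2)[OF C, of _ 0]]
    show ?thesis by (simp add: p_def[symmetric])
  qed
  have "p \<noteq> 0" using fp f.zero by auto
  have "f x = x \<bullet> ((1 / (p \<bullet> p)) *\<^sub>R p)" for x
  proof -
    have "p \<bullet> (x - f x *\<^sub>R p) = 0"
      by (rule normal) (simp add: f.diff f.scaleR fp)
    then show ?thesis
      using \<open>p \<noteq> 0\<close> by (simp add: inner_diff_right inner_commute field_simps)
  qed
  then show thesis by (rule that)
qed

text \<open>The adjoint is a choice among all maps satisfying the adjoint identity, so the identity holds
  as soon as one such map exists; its value at \<open>y\<close> represents the functional \<open>\<lambda>x. L x \<bullet> y\<close>.\<close>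

lemma inner_adjoint:
  fixes L :: "'a::{real_inner, complete_space} \<Rightarrow> 'b::real_inner"
  assumes "bounded_linear L"
  shows "x \<bullet> adjoint L y = L x \<bullet> y"
proof -
  have "\<exists>r. \<forall>x. L x \<bullet> y = x \<bullet> r" for y
  proof -
    have "bounded_linear (\<lambda>x. L x \<bullet> y)"
      using assms by (rule bounded_linear_inner_left_comp)
    from riesz_representation[OF this] show ?thesis by metis
  qed
  then obtain g where g: "\<And>x y. L x \<bullet> y = x \<bullet> g y" by metis
  then have "adjoint L = g"
    by (intro adjoint_unique) simp
  with g show ?thesis by simp
qed

lemma linear_adjoint:
  fixes L :: "'a::{real_inner, complete_space} \<Rightarrow> 'b::real_inner"
  assumes "bounded_linear L"
  shows "linear (adjoint L)"
proof (rule linearI)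
  note adj = inner_adjoint[OF assms]
  show "adjoint L (y + z) = adjoint L y + adjoint L z" for y z
    by (rule vector_eq_ldot[THEN iffD1]) (simp add: adj inner_add_right)
  show "adjoint L (c *\<^sub>R y) = c *\<^sub>R adjoint L y" for c y
    by (rule vector_eq_ldot[THEN iffD1]) (simp add: adj)
qed

section \<open>Maximally monotone operators\<close>

lemma monotone_operatorD:
  assumes "monotone_operator A" "(x, u) \<in> A" "(y, v) \<in> A"
  shows "0 \<le> (x - y) \<bullet> (u - v)"
  using bspec[OF bspec[OF assms(1)[unfolded monotone_operator_def] assms(2), simplified] assms(3)]
  by simp

lemma maximally_monotoneD:
  assumes "maximally_monotone A" "(x, u) \<in> A" "(y, v) \<in> A"
  shows "0 \<le> (x - y) \<bullet> (u - v)"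
  using assms monotone_operatorD unfolding maximally_monotone_def by blast

lemma maximally_monotone_iff:
  assumes A: "maximally_monotone A"
  shows "(x, u) \<in> A \<longleftrightarrow> (\<forall>(y, v) \<in> A. 0 \<le> (x - y) \<bullet> (u - v))"
proof
  assume "(x, u) \<in> A"
  then show "\<forall>(y, v) \<in> A. 0 \<le> (x - y) \<bullet> (u - v)"
    using maximally_monotoneD[OF A] by blast
next
  assume rel: "\<forall>(y, v) \<in> A. 0 \<le> (x - y) \<bullet> (u - v)"
  have "(y - x) \<bullet> (v - u) = (x - y) \<bullet> (u - v)" for y v
    by (simp add: inner_diff_left inner_diff_right)
  then have "monotone_operator (insert (x, u) A)"
    using rel maximally_monotoneD[OF A] unfolding monotone_operator_def by auto
  then have "insert (x, u) A = A"
    using A unfolding maximally_monotone_def by blast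
  then show "(x, u) \<in> A" by blast
qed

lemma maximally_monotone_inverse:
  assumes A: "maximally_monotone A"
  shows "maximally_monotone (A\<inverse>)"
  unfolding maximally_monotone_def
proof (intro conjI allI impI)
  have swap: "monotone_operator (B\<inverse>)" if "monotone_operator B" for B :: "'a rel"
    using that unfolding monotone_operator_def by (force simp: inner_commute)
  show "monotone_operator (A\<inverse>)"
    using A swap unfolding maximally_monotone_def by blast
  fix B assume B: "monotone_operator B \<and> A\<inverse> \<subseteq> B"
  then have "monotone_operator (B\<inverse>)" "A \<subseteq> B\<inverse>"
    using swap by auto
  then have "B\<inverse> = A"
    using A unfolding maximally_monotone_def by blast
  then show "B = A\<inverse>" by auto
qed

text \<open>By maximality, \<open>A x\<close> is the set of all \<open>u\<close> monotonically related to the graph, an intersection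
  of closed half-spaces.\<close>

lemma maximally_monotone_image_closed_convex:
  assumes A: "maximally_monotone A"
  shows "closed (A `` {x})" "convex (A `` {x})"
proof -
  have eq: "A `` {x} = (\<Inter>(y, v) \<in> A. {u. (x - y) \<bullet> v \<le> (x - y) \<bullet> u})"
    using maximally_monotone_iff[OF A, of x] by (auto simp: inner_diff_right)
  show "closed (A `` {x})"
    unfolding eq by (auto intro!: closed_INT closed_Collect_le continuous_intros)
  show "convex (A `` {x})"
    unfolding eq by (intro convex_INT ballI, auto simp: convex_halfspace_ge)
qed

lemma resolvent_eq_singleton:
  assumes A: "maximally_monotone A" and "\<rho> > 0" and u: "(z, u) \<in> A"
  shows "resolvent (op_scale \<rho> A) `` {z + \<rho> *\<^sub>R u} = {z}"
proof -
  have iff: "(q, w) \<in> resolvent (op_scale \<rho> A) \<longleftrightarrow> (\<exists>v. (w, v) \<in> A \<and> q = w + \<rho> *\<^sub>R v)" for q w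
    unfolding resolvent_def op_plus_def op_scale_def by auto
  have "w = z" if w: "(w, v) \<in> A" and eq: "z + \<rho> *\<^sub>R u = w + \<rho> *\<^sub>R v" for w v
  proof -
    have diff: "w - z = \<rho> *\<^sub>R (u - v)"
      using eq by (simp add: algebra_simps)
    have "0 \<le> (w - z) \<bullet> (\<rho> *\<^sub>R (v - u))"
      using maximally_monotoneD[OF A w u] \<open>\<rho> > 0\<close> by simp
    also have "\<rho> *\<^sub>R (v - u) = - (w - z)"
      using diff by (simp add: algebra_simps)
    finally have "(w - z) \<bullet> (w - z) \<le> 0"
      by (simp only: inner_minus_right)
    then show "w = z"
      by (simp flip: power2_norm_eq_inner)
  qed
  with u show ?thesis by (auto simp: iff)
qed

section \<open>Pairing of primal and dual solutions\<close>

lemma primal_solutions_iff: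
  "z \<in> primal_solutions L A B \<longleftrightarrow> (\<exists>y. (z, - adjoint L y) \<in> A \<and> (L z, y) \<in> B)"
  unfolding primal_solutions_def set_plus_def
  by (auto simp: eq_neg_iff_add_eq_0[symmetric] eq_commute[of 0])

lemma dual_solutions_iff:
  "k \<in> dual_solutions L A B \<longleftrightarrow> (\<exists>z. (z, - adjoint L k) \<in> A \<and> (L z, k) \<in> B)"
  unfolding dual_solutions_def minkowski_diff_def by auto

text \<open>If \<open>y\<close> certifies \<open>z\<close> and \<open>k\<close> is certified by \<open>w\<close>, the monotonicity terms
  \<open>\<langle>z - w, L\<^sup>* k - L\<^sup>* y\<rangle>\<close> and \<open>\<langle>L z - L w, y - k\<rangle>\<close> add up to zero. Both vanish, and
  paramonotonicity exchanges the partners.\<close>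

lemma primal_dual_pairing:
  fixes L :: "'a::{real_inner, complete_space} \<Rightarrow> 'b::real_inner"
  assumes L: "bounded_linear L" and A: "paramonotone A" and B: "paramonotone B"
    and z: "z \<in> primal_solutions L A B" and k: "k \<in> dual_solutions L A B"
  shows "(z, - adjoint L k) \<in> A" "(L z, k) \<in> B"
proof -
  obtain y where zy: "(z, - adjoint L y) \<in> A" "(L z, y) \<in> B"
    using z primal_solutions_iff by blast
  obtain w where wk: "(w, - adjoint L k) \<in> A" "(L w, k) \<in> B"
    using k dual_solutions_iff by blast
  have "(z - w) \<bullet> (- adjoint L y - - adjoint L k) \<ge> 0"
    using A zy(1) wk(1) monotone_operatorD unfolding paramonotone_def by blast
  moreover have "(L z - L w) \<bullet> (y - k) \<ge> 0"
    using B zy(2) wk(2) monotone_operatorD unfolding paramonotone_def by blast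
  moreover have "(z - w) \<bullet> (- adjoint L y - - adjoint L k) = - ((L z - L w) \<bullet> (y - k))"
    by (simp add: inner_diff_left inner_diff_right inner_adjoint[OF L]
        linear_diff[OF bounded_linear.linear[OF L]])
  ultimately have "(z - w) \<bullet> (- adjoint L y - - adjoint L k) = 0" "(L z - L w) \<bullet> (y - k) = 0"
    by linarith+
  with A B zy wk show "(z, - adjoint L k) \<in> A" "(L z, k) \<in> B"
    unfolding paramonotone_def by blast+
qed

lemma primal_solutions_closed_convex:
  fixes L :: "'a::{real_inner, complete_space} \<Rightarrow> 'b::real_inner"
  assumes L: "bounded_linear L" and A: "maximally_monotone A" "paramonotone A"
    and B: "maximally_monotone B" "paramonotone B" and k: "k \<in> dual_solutions L A B"
  shows "closed (primal_solutions L A B)" "convex (primal_solutions L A B)"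
proof -
  have eq: "primal_solutions L A B = A\<inverse> `` {- adjoint L k} \<inter> L -` (B\<inverse> `` {k})"
    using primal_dual_pairing[OF L A(2) B(2) _ k] by (auto simp: primal_solutions_iff)
  note fibres = maximally_monotone_image_closed_convex[OF maximally_monotone_inverse]
  show "closed (primal_solutions L A B)"
    unfolding eq using fibres(1)[OF A(1)] fibres(1)[OF B(1)] L
    by (intro closed_Int closed_vimage linear_continuous_on) auto
  show "convex (primal_solutions L A B)"
    unfolding eq using fibres(2)[OF A(1)] fibres(2)[OF B(1)] bounded_linear.linear[OF L]
    by (intro convex_Int convex_linear_vimage) auto
qed

lemma convex_adjoint_dual_solutions:
  fixes L :: "'a::{real_inner, complete_space} \<Rightarrow> 'b::real_inner"
  assumes L: "bounded_linear L" and A: "maximally_monotone A" "paramonotone A"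
    and B: "maximally_monotone B" "paramonotone B" and z: "z \<in> primal_solutions L A B"
  shows "convex (adjoint L ` dual_solutions L A B)"
proof -
  note lin = linear_adjoint[OF L]
  have eq: "dual_solutions L A B = (\<lambda>k. - adjoint L k) -` (A `` {z}) \<inter> B `` {L z}"
    using primal_dual_pairing[OF L A(2) B(2) z] by (auto simp: dual_solutions_iff)
  have "convex (dual_solutions L A B)"
    unfolding eq
    using maximally_monotone_image_closed_convex(2)[OF A(1)]
      maximally_monotone_image_closed_convex(2)[OF B(1)] linear_compose_neg[OF lin]
    by (intro convex_Int convex_linear_vimage) auto
  then show ?thesis
    by (rule convex_linear_image[OF lin])
qed

text \<open>Closedness of \<open>A z\<close> extends the pairing to the closure of \<open>L\<^sup>* K\<close>, where monotonicity may then
  be applied crosswise.\<close>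

lemma neg_closure_adjoint_dual_solutions_in_image:
  fixes L :: "'a::{real_inner, complete_space} \<Rightarrow> 'b::real_inner"
  assumes L: "bounded_linear L" and A: "maximally_monotone A" "paramonotone A"
    and B: "paramonotone B" and z: "z \<in> primal_solutions L A B"
    and d: "d \<in> closure (adjoint L ` dual_solutions L A B)"
  shows "(z, - d) \<in> A"
proof -
  have "closure (adjoint L ` dual_solutions L A B) \<subseteq> uminus -` (A `` {z})"
  proof (rule closure_minimal)
    show "adjoint L ` dual_solutions L A B \<subseteq> uminus -` (A `` {z})"
      using primal_dual_pairing(1)[OF L A(2) B z] by auto
    show "closed (uminus -` (A `` {z}))"
      using maximally_monotone_image_closed_convex(1)[OF A(1)]
      by (intro closed_vimage continuous_intros)
  qed
  with d show ?thesis by auto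
qed

lemma primal_dual_directions_orthogonal:
  fixes L :: "'a::{real_inner, complete_space} \<Rightarrow> 'b::real_inner"
  assumes L: "bounded_linear L" and A: "maximally_monotone A" "paramonotone A"
    and B: "paramonotone B" and z: "z \<in> primal_solutions L A B" "w \<in> primal_solutions L A B"
    and d: "d \<in> closure (adjoint L ` dual_solutions L A B)"
      "e \<in> closure (adjoint L ` dual_solutions L A B)"
  shows "(z - w) \<bullet> (d - e) = 0"
proof -
  note graph = neg_closure_adjoint_dual_solutions_in_image[OF L A B]
  have "0 \<le> (z - w) \<bullet> (- d - - e)"
    using graph z d by (intro maximally_monotoneD[OF A(1)])
  moreover have "0 \<le> (z - w) \<bullet> (- e - - d)"
    using graph z d by (intro maximally_monotoneD[OF A(1)])
  ultimately show ?thesis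
    by (simp add: inner_diff_right)
qed

section \<open>Resolvent of the projection onto the solution sets\<close>

lemma resolvent_projection_solutions:
  fixes L :: "'a::{real_inner, complete_space} \<Rightarrow> 'b::real_inner"
  assumes L: "bounded_linear L" and A: "maximally_monotone A" "paramonotone A"
    and B: "maximally_monotone B" "paramonotone B" and "\<rho> > 0"
    and k: "k \<in> dual_solutions L A B"
  shows "resolvent (op_scale \<rho> A) ``
      {projection (primal_solutions L A B \<ominus>\<^sub>M \<rho> \<cdot>\<^sub>M closure (adjoint L ` dual_solutions L A B)) x}
    = {projection (primal_solutions L A B) (x + \<rho> *\<^sub>R adjoint L k)}"
proof -
  let ?Z = "primal_solutions L A B" and ?D = "closure (adjoint L ` dual_solutions L A B)"
  let ?p = "projection ?Z (x + \<rho> *\<^sub>R adjoint L k)"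
  obtain z where z: "z \<in> ?Z"
    using k primal_solutions_iff dual_solutions_iff by metis
  then have Z: "closed ?Z" "convex ?Z" "?Z \<noteq> {}"
    using primal_solutions_closed_convex[OF L A B k] by auto
  have D: "closed ?D" "convex ?D"
    using convex_closure[OF convex_adjoint_dual_solutions[OF L A B z]] by auto
  have "(z - w) \<bullet> (d - e) = 0" if "z \<in> ?Z" "w \<in> ?Z" "d \<in> ?D" "e \<in> ?D" for z w d e
    using that by (rule primal_dual_directions_orthogonal[OF L A B(2)])
  moreover have "adjoint L k \<in> ?D"
    using k by (intro subsetD[OF closure_subset] imageI)
  ultimately obtain e where e: "e \<in> ?D" and eq: "projection (?Z \<ominus>\<^sub>M \<rho> \<cdot>\<^sub>M ?D) x = ?p - \<rho> *\<^sub>R e"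
    using projection_orthogonal_difference[OF Z D _ \<open>\<rho> > 0\<close>, of "adjoint L k" x] by blast
  have "?p \<in> ?Z"
    by (rule projection_variational(1)[OF Z])
  then have "(?p, - e) \<in> A"
    using e by (rule neg_closure_adjoint_dual_solutions_in_image[OF L A B(2)])
  from resolvent_eq_singleton[OF A(1) \<open>\<rho> > 0\<close> this] show ?thesis
    by (simp add: eq)
qed

theorem theorem8p2:
  fixes L :: "'a::{real_inner, complete_space} \<Rightarrow> 'b::{real_inner, complete_space}"
    and A :: "'a rel" and B :: "'b rel"
    and \<rho> :: real and x :: 'a
  defines "Z \<equiv> primal_solutions L A B"
    and "K \<equiv> dual_solutions L A B"
  assumes "bounded_linear L"
    and "maximally_monotone A" and "maximally_monotone B"
    and "paramonotone A" and "paramonotone B"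
    and "\<rho> > 0"
  shows "(\<forall>k\<^sub>0 \<in> K.
            resolvent (op_scale \<rho> A) `` {projection (Z \<ominus>\<^sub>M \<rho> \<cdot>\<^sub>M closure (adjoint L ` K)) x}
              = {projection Z (x + \<rho> *\<^sub>R adjoint L k\<^sub>0)})
       \<and> (\<forall>z\<^sub>0 \<in> Z. orthogonal_sets (Z \<ominus>\<^sub>M {z\<^sub>0}) (\<rho> \<cdot>\<^sub>M adjoint L ` K) \<longrightarrow>
            resolvent (op_scale \<rho> A) `` {projection (Z \<ominus>\<^sub>M \<rho> \<cdot>\<^sub>M closure (adjoint L ` K)) x}
              = {projection Z x})
       \<and> (K \<inter> {y. adjoint L y = 0} \<noteq> {} \<longrightarrow>
            resolvent (op_scale \<rho> A) `` {projection (Z \<ominus>\<^sub>M \<rho> \<cdot>\<^sub>M closure (adjoint L ` K)) x}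
              = {projection Z x})"
proof (intro conjI ballI impI)
  note A = \<open>maximally_monotone A\<close> \<open>paramonotone A\<close>
  note B = \<open>maximally_monotone B\<close> \<open>paramonotone B\<close>
  let ?J = "resolvent (op_scale \<rho> A)" and ?q = "projection (Z \<ominus>\<^sub>M \<rho> \<cdot>\<^sub>M closure (adjoint L ` K)) x"
  have main: "?J `` {?q} = {projection Z (x + \<rho> *\<^sub>R adjoint L k)}" if "k \<in> K" for k
    using resolvent_projection_solutions[OF \<open>bounded_linear L\<close> A B \<open>\<rho> > 0\<close>] that
    unfolding Z_def K_def by blast
  show "?J `` {?q} = {projection Z (x + \<rho> *\<^sub>R adjoint L k\<^sub>0)}" if "k\<^sub>0 \<in> K" for k\<^sub>0
    using that by (rule main)
  show "?J `` {?q} = {projection Z x}"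
    if z\<^sub>0: "z\<^sub>0 \<in> Z" and orth: "orthogonal_sets (Z \<ominus>\<^sub>M {z\<^sub>0}) (\<rho> \<cdot>\<^sub>M adjoint L ` K)" for z\<^sub>0
  proof -
    obtain k where k: "k \<in> K"
      using z\<^sub>0 unfolding Z_def K_def by (metis primal_solutions_iff dual_solutions_iff)
    have "(z - z\<^sub>0) \<bullet> (\<rho> *\<^sub>R adjoint L k) = 0" if "z \<in> Z" for z
      using orth that k
      unfolding orthogonal_sets_def orthogonal_def minkowski_diff_def minkowski_scale_def by blast
    moreover have "closed Z" "convex Z" "Z \<noteq> {}"
      using primal_solutions_closed_convex[OF \<open>bounded_linear L\<close> A B] k z\<^sub>0
      unfolding Z_def K_def by auto
    ultimately have "projection Z (x + \<rho> *\<^sub>R adjoint L k) = projection Z x"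
      by (intro projection_shift_orthogonal)
    with main[OF k] show ?thesis by simp
  qed
  show "?J `` {?q} = {projection Z x}" if "K \<inter> {y. adjoint L y = 0} \<noteq> {}"
  proof -
    obtain k where "k \<in> K" "adjoint L k = 0"
      using \<open>K \<inter> {y. adjoint L y = 0} \<noteq> {}\<close> by blast
    with main[of k] show ?thesis by simp
  qed
qed

end
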